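(* For every family $(L_i)_{i\in I}$ of countable frames (indexed by an arbitrary set $I$), $$\Sigma\Big(\prod_{i\in I}L_i\Big)=\prod_{i\in I}\Sigma L_i,$$ i.e. the Scott topology of the coordinatewise order on $\prod_{i\in I}L_i$ equals the product of the Scott topologies of the $L_i$. In particular, this holds for arbitrary powers of every countable frame.
   Context: A frame (equivalently, complete Heyting algebra) is a complete lattice $L$ with $a\wedge\bigvee S=\bigvee_{s\in S}(a\wedge s)$ for all $a\in L$, $S\subseteq L$; it is countable if its underlying set is countable. For a poset $P$, a subset $U$ is Scott open if it is an upper set and every directed set $D$ having a supremum $\bigvee D\in U$ meets $U$ (directed sets are nonempty); $\Sigma P$ is $P$ with the topology of Scott-open sets. *)

theory Defs
  imports "HOL-Analysis.Analysis" "HOL-Algebra.Complete_Lattice"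
begin

locale frame = complete_lattice +
  assumes inf_Sup_distrib:
    "\<lbrakk>a \<in> carrier L; S \<subseteq> carrier L\<rbrakk> \<Longrightarrow> a \<sqinter> (\<Squnion>S) = \<Squnion>((\<lambda>s. a \<sqinter> s) ` S)"

locale countable_frame = frame +
  assumes countable_carrier: "countable (carrier L)"

definition directed :: "('a, 'b) gorder_scheme \<Rightarrow> 'a set \<Rightarrow> bool" where
  "directed P D \<longleftrightarrow> D \<subseteq> carrier P \<and> D \<noteq> {} \<and>
     (\<forall>x\<in>D. \<forall>y\<in>D. \<exists>z\<in>D. x \<sqsubseteq>\<^bsub>P\<^esub> z \<and> y \<sqsubseteq>\<^bsub>P\<^esub> z)"

definition scott_open :: "('a, 'b) gorder_scheme \<Rightarrow> 'a set \<Rightarrow> bool" where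
  "scott_open P U \<longleftrightarrow> U \<subseteq> carrier P \<and>
     (\<forall>x\<in>U. \<forall>y\<in>carrier P. x \<sqsubseteq>\<^bsub>P\<^esub> y \<longrightarrow> y \<in> U) \<and>
     (\<forall>D s. directed P D \<longrightarrow> is_lub P s D \<longrightarrow> s \<in> U \<longrightarrow> D \<inter> U \<noteq> {})"

lemma istopology_scott_open: "istopology (scott_open P)"
  unfolding istopology_def
proof (intro conjI allI impI)
  fix U V assume U: "scott_open P U" and V: "scott_open P V"
  have "D \<inter> (U \<inter> V) \<noteq> {}"
    if D: "directed P D" and s: "is_lub P s D" "s \<in> U \<inter> V" for D s
  proof -
    obtain u v where "u \<in> D \<inter> U" "v \<in> D \<inter> V"
      using U V D s unfolding scott_open_def by blast
    moreover from this obtain w where "w \<in> D" "u \<sqsubseteq>\<^bsub>P\<^esub> w" "v \<sqsubseteq>\<^bsub>P\<^esub> w"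
      using D unfolding directed_def by blast
    moreover have "w \<in> carrier P"
      using D \<open>w \<in> D\<close> unfolding directed_def by blast
    ultimately show ?thesis
      using U V unfolding scott_open_def by blast
  qed
  moreover have "y \<in> U \<inter> V" if "x \<in> U \<inter> V" "y \<in> carrier P" "x \<sqsubseteq>\<^bsub>P\<^esub> y" for x y
  proof (rule IntI)
    show "y \<in> U" using U that unfolding scott_open_def by blast
    show "y \<in> V" using V that unfolding scott_open_def by blast
  qed
  moreover have "U \<inter> V \<subseteq> carrier P"
    using U by (simp add: scott_open_def le_infI1)
  ultimately show "scott_open P (U \<inter> V)"
    unfolding scott_open_def by (intro conjI allI ballI impI)
next
  fix \<U> assume \<U>: "\<forall>U\<in>\<U>. scott_open P U"
  show "scott_open P (\<Union>\<U>)"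
    unfolding scott_open_def
  proof (intro conjI allI impI ballI)
    show "\<Union>\<U> \<subseteq> carrier P"
      using \<U> by (simp add: Sup_le_iff scott_open_def)
  next
    fix x y assume "x \<in> \<Union>\<U>" "y \<in> carrier P" "x \<sqsubseteq>\<^bsub>P\<^esub> y"
    then obtain U where "U \<in> \<U>" "x \<in> U"
      by blast
    then have "y \<in> U"
      using \<U> \<open>y \<in> carrier P\<close> \<open>x \<sqsubseteq>\<^bsub>P\<^esub> y\<close> by (simp add: scott_open_def)
    then show "y \<in> \<Union>\<U>"
      using \<open>U \<in> \<U>\<close> by blast
  next
    fix D s assume "directed P D" "is_lub P s D" "s \<in> \<Union>\<U>"
    then obtain U where "U \<in> \<U>" "s \<in> U"
      by blast
    then have "D \<inter> U \<noteq> {}"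
      using \<U> \<open>directed P D\<close> \<open>is_lub P s D\<close> by (simp add: scott_open_def)
    then show "D \<inter> \<Union>\<U> \<noteq> {}"
      using \<open>U \<in> \<U>\<close> by blast
  qed
qed

definition scott_topology :: "('a, 'b) gorder_scheme \<Rightarrow> 'a topology" where
  "scott_topology P = topology (scott_open P)"

lemma openin_scott_topology [simp]: "openin (scott_topology P) = scott_open P"
  by (simp add: scott_topology_def istopology_scott_open)

lemma scott_open_carrier: "scott_open P (carrier P)"
  unfolding scott_open_def directed_def by blast

lemma topspace_scott_topology [simp]: "topspace (scott_topology P) = carrier P"
proof (rule subset_antisym)
  show "topspace (scott_topology P) \<subseteq> carrier P"
    unfolding topspace_def by (simp add: Sup_le_iff scott_open_def)
  show "carrier P \<subseteq> topspace (scott_topology P)"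
    using openin_subset[of "scott_topology P" "carrier P"] scott_open_carrier[of P] by simp
qed

text \<open>The product of an indexed family of orders consists of the extensional
  functions, so that its carrier is the underlying set of
  \<^const>\<open>product_topology\<close>.\<close>

definition product_order :: "'i set \<Rightarrow> ('i \<Rightarrow> ('a, 'b) gorder_scheme) \<Rightarrow> ('i \<Rightarrow> 'a) gorder" where
  "product_order I L =
     \<lparr>carrier = (\<Pi>\<^sub>E i\<in>I. carrier (L i)), eq = (=),
      le = (\<lambda>x y. \<forall>i\<in>I. x i \<sqsubseteq>\<^bsub>L i\<^esub> y i)\<rparr>"

end

theory Submission
  imports Defs
begin

text \<open>Truncating a point of a Scott-open subset \<open>U\<close> of the product to finitely many coordinates
  (bottom elsewhere) reduces the problem to enclosing a point of a finite product in a box of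
  Scott-open sets inside \<open>U\<close>. The box is spanned by the union of countably many finite stages
  that stay inside \<open>U\<close>. In general there are uncountably many directed sets with supremum \<open>p\<close> that
  the factors of the box must meet, and no countable family of them is coinitial. They
  are handled through pairs \<open>e \<le> p\<close>, which stand for all directed sets \<open>D\<close> with supremum \<open>p\<close> whose
  lower closure contains \<open>e\<close>. Two moves simplify a pair: replace it by \<open>(e \<sqinter> c, c)\<close>, where
  \<open>c \<le> p\<close> can be found in every Scott-open neighbourhood of \<open>p\<close> (the sets \<open>{c \<sqinter> d | d \<in> D}\<close> have
  supremum \<open>c\<close> by the frame law), or replace it by all pairs \<open>(d, p)\<close> with \<open>d \<ge> e\<close> in a fixed
  Scott-open neighbourhood of \<open>p\<close> (which \<open>D\<close> meets). If transfinitely many moves did not resolve all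
  pairs, every unresolved pair \<open>(e, p)\<close> would split into unresolved pairs \<open>(e, d)\<close> and \<open>(d, p)\<close>,
  and such a dense system of intervals cannot exist in a countable complete lattice. Hence the
  pairs carry a well-founded rank, and closing the stages under the first move for countably many
  pairs makes the factors Scott open by induction on the rank.\<close>

section \<open>Ranks of inductively exhausted sets\<close>

text \<open>The transfinite iterates of \<open>C \<mapsto> C \<union> F C\<close>, indexed without ordinals.\<close>

inductive tower :: "('a set \<Rightarrow> 'a set) \<Rightarrow> 'a set \<Rightarrow> bool" for F where
  step: "tower F C \<Longrightarrow> tower F (C \<union> F C)"
| Union: "(\<And>C. C \<in> \<C> \<Longrightarrow> tower F C) \<Longrightarrow> tower F (\<Union>\<C>)"

text \<open>Zermelo's argument that the iterates form a chain, with no monotonicity of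
  \<open>F\<close> to lean on: the outer induction is on \<open>C\<close>, and its successor case
  rests on an inner induction on \<open>D\<close>.\<close>

lemma tower_comparable:
  assumes "tower F C" "tower F D"
  shows "C \<subseteq> D \<or> D \<union> F D \<subseteq> C"
  using assms
proof (induction C arbitrary: D rule: tower.induct)
  case (step C)
  \<comment> \<open>No stage lies strictly between \<open>C\<close> and its successor.\<close>
  have "C \<union> F C \<subseteq> D \<or> D = C" if "tower F D" "C \<subseteq> D" for D
    using that
  proof (induction D rule: tower.induct)
    case (step D)
    then show ?case using \<open>\<And>D. tower F D \<Longrightarrow> C \<subseteq> D \<or> D \<union> F D \<subseteq> C\<close> by blast
  next
    case (Union \<D>)
    show ?case
    proof (cases "\<exists>D\<in>\<D>. C \<union> F C \<subseteq> D")
      case True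
      then show ?thesis by blast
    next
      case False
      have "D \<subseteq> C" if "D \<in> \<D>" for D
        using Union.IH[OF that] Union.hyps[OF that] False that step.IH[of D] by blast
      then show ?thesis using Union.prems by blast
    qed
  qed
  then show ?case using step by blast
next
  case (Union \<C>)
  then show ?case by blast
qed

text \<open>\<open>y\<close> precedes \<open>x\<close> when some stage contains \<open>y\<close> but
  misses \<open>x\<close>. The predecessors of \<open>x\<close> therefore form the largest stage
  missing \<open>x\<close>, and by \<open>progress\<close> the next application of \<open>F\<close>
  must add \<open>x\<close>.\<close>

lemma wf_rank:
  fixes F :: "'a set \<Rightarrow> 'a set"
  assumes progress: "\<And>D. \<not> S \<subseteq> D \<Longrightarrow> \<exists>z\<in>S - D. z \<in> F D"
  obtains r where "wf r" "\<And>x. x \<in> S \<Longrightarrow> x \<in> F {y. (y, x) \<in> r}"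
proof -
  define r where "r = {(y, x). \<exists>D. tower F D \<and> y \<in> D \<and> x \<notin> D}"
  \<comment> \<open>By comparability, every stage missing an element of
    \<open>C \<union> F C\<close> is contained in \<open>C\<close>, so all predecessors of that
    element are accessible already.\<close>
  have acc: "tower F D \<Longrightarrow> x \<in> D \<Longrightarrow> x \<in> Wellfounded.acc r" for D x
  proof (induction D arbitrary: x rule: tower.induct)
    case (step C)
    show ?case
    proof (rule accI)
      fix y assume "(y, x) \<in> r"
      then obtain E where E: "tower F E" "y \<in> E" "x \<notin> E"
        unfolding r_def by blast
      then have "E \<subseteq> C"
        using tower_comparable[OF E(1) step.hyps] step.prems by blast
      then show "y \<in> Wellfounded.acc r" using E step.IH by blast
    qed
  next
    case (Union \<C>)
    then show ?case by blast
  qed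
  \<comment> \<open>This includes elements that never enter the tower: their predecessors lie in
    stages.\<close>
  have "x \<in> Wellfounded.acc r" for x
  proof (rule accI)
    fix y assume "(y, x) \<in> r"
    then show "y \<in> Wellfounded.acc r" unfolding r_def using acc[unfolded r_def] by blast
  qed
  then have "wf r" by (simp add: wf_iff_acc)
  moreover have "x \<in> F {y. (y, x) \<in> r}" if x: "x \<in> S" for x
  proof -
    define D where "D = \<Union>{C. tower F C \<and> x \<notin> C}"
    have D: "tower F D" "x \<notin> D" "D = {y. (y, x) \<in> r}"
      unfolding D_def r_def by (auto intro: tower.Union)
    have "x \<in> F D"
    proof (rule ccontr)
      assume "x \<notin> F D"
      \<comment> \<open>The successor of \<open>D\<close> would still miss \<open>x\<close>, hence
        be one of the stages united in \<open>D\<close>.\<close>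
      then have "D \<union> F D \<subseteq> D"
        using D(2) tower.step[OF D(1)] unfolding D_def by blast
      then show False using progress[of D] x D(2) by blast
    qed
    then show ?thesis using D(3) by simp
  qed
  ultimately show thesis using that by blast
qed

section \<open>Countable frames\<close>

lemma (in complete_lattice) no_dense_set_of_intervals:
  assumes cnt: "countable (carrier L)"
    and sub: "\<And>e p. (e, p) \<in> N \<Longrightarrow> e \<in> carrier L \<and> p \<in> carrier L \<and> e \<sqsubseteq> p \<and> e \<noteq> p"
    and dense: "\<And>e p. (e, p) \<in> N \<Longrightarrow> \<exists>d. (e, d) \<in> N \<and> (d, p) \<in> N"
  shows "N = {}"
proof (rule ccontr)
  assume "N \<noteq> {}"
  then obtain e0 p0 where N0: "(e0, p0) \<in> N" by auto
  then have ne: "carrier L \<noteq> {}" using sub by blast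
  \<comment> \<open>A sequence of nested intervals whose \<open>n\<close>-th step avoids the \<open>n\<close>-th element of the lattice;
    the supremum of the left end points lies in all of them.\<close>
  define a where "a = from_nat_into (carrier L)"
  have split: "\<exists>J. J \<in> N \<and> fst I \<sqsubseteq> fst J \<and> snd J \<sqsubseteq> snd I \<and>
      \<not> (fst J \<sqsubseteq> a n \<and> a n \<sqsubseteq> snd J)" if "I \<in> N" for I n
  proof -
    obtain e p where I: "I = (e, p)" by fastforce
    \<comment> \<open>One split gives two intervals sharing the end point \<open>d'\<close>, and
      \<open>a n\<close> might be that point. The second split leaves a gap: \<open>d\<close> is
      strictly below \<open>d'\<close>, so \<open>a n\<close> cannot lie both between
      \<open>e\<close> and \<open>d\<close> and between \<open>d'\<close> and
      \<open>p\<close>.\<close>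
    obtain d' where d': "(e, d') \<in> N" "(d', p) \<in> N" using dense \<open>I \<in> N\<close> I by blast
    obtain d where d: "(e, d) \<in> N" "(d, d') \<in> N" using dense d' by blast
    have "d' \<sqsubseteq> a n \<Longrightarrow> a n \<sqsubseteq> d \<Longrightarrow> False"
      using sub[OF d(2)] sub[OF d(1)] le_trans[of d' "a n" d] from_nat_into[OF ne, of n]
      unfolding a_def by blast
    moreover have "d \<sqsubseteq> p" "e \<sqsubseteq> d'"
      using sub[OF d(1)] sub[OF d(2)] sub[OF d'(1)] sub[OF d'(2)] le_trans by blast+
    moreover have "e \<sqsubseteq> e" "p \<sqsubseteq> p"
      using sub[OF d(1)] sub[OF d'(2)] by auto
    ultimately consider "\<not> (e \<sqsubseteq> a n \<and> a n \<sqsubseteq> d)" | "\<not> (d' \<sqsubseteq> a n \<and> a n \<sqsubseteq> p)"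
      by blast
    then show ?thesis
    proof cases
      case 1
      then show ?thesis
        using d(1) \<open>e \<sqsubseteq> e\<close> \<open>d \<sqsubseteq> p\<close> by (intro exI[of _ "(e, d)"]) (simp add: I)
    next
      case 2
      then show ?thesis
        using d'(2) \<open>e \<sqsubseteq> d'\<close> \<open>p \<sqsubseteq> p\<close> by (intro exI[of _ "(d', p)"]) (simp add: I)
    qed
  qed
  have "\<exists>I. \<forall>n. I n \<in> N \<and> (fst (I n) \<sqsubseteq> fst (I (Suc n)) \<and> snd (I (Suc n)) \<sqsubseteq> snd (I n) \<and>
      \<not> (fst (I (Suc n)) \<sqsubseteq> a n \<and> a n \<sqsubseteq> snd (I (Suc n))))"
    by (rule dependent_nat_choice) (use N0 split in blast)+
  then obtain I where I: "\<And>n. I n \<in> N" "\<And>n. fst (I n) \<sqsubseteq> fst (I (Suc n))"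
      "\<And>n. snd (I (Suc n)) \<sqsubseteq> snd (I n)"
      "\<And>n. \<not> (fst (I (Suc n)) \<sqsubseteq> a n \<and> a n \<sqsubseteq> snd (I (Suc n)))"
    by blast
  have c: "fst (I n) \<in> carrier L" "snd (I n) \<in> carrier L" "fst (I n) \<sqsubseteq> snd (I n)" for n
    using sub[of "fst (I n)" "snd (I n)"] I(1)[of n] by simp_all
  have mono: "m \<le> n \<Longrightarrow> fst (I m) \<sqsubseteq> fst (I n) \<and> snd (I n) \<sqsubseteq> snd (I m)" for m n
  proof (induction n rule: dec_induct)
    case base
    then show ?case using c by simp
  next
    case (step n)
    then show ?case using I(2,3)[of n] c le_trans by meson
  qed
  have between: "fst (I m) \<sqsubseteq> snd (I n)" for m n
  proof -
    have up: "fst (I m) \<sqsubseteq> fst (I (max m n))" and down: "snd (I (max m n)) \<sqsubseteq> snd (I n)"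
      using mono by simp_all
    have "fst (I m) \<sqsubseteq> snd (I (max m n))"
      using up c(3) by (rule le_trans) (rule c)+
    then show ?thesis using down by (rule le_trans) (rule c)+
  qed
  define s where "s = \<Squnion>\<^bsub>L\<^esub>(range (fst \<circ> I))"
  have lub: "is_lub L s (range (fst \<circ> I))"
    unfolding s_def by (rule sup_lub) (use c in auto)
  have s: "s \<in> carrier L" "fst (I n) \<sqsubseteq> s" for n
  proof -
    have "range (fst \<circ> I) \<subseteq> carrier L" using c by auto
    then show "s \<in> carrier L" "fst (I n) \<sqsubseteq> s"
      using least_closed[OF lub] least_Upper_above[OF lub, of "fst (I n)"] by auto
  qed
  have "s \<sqsubseteq> snd (I n)" for n
  proof (rule least_le[OF lub], rule Upper_memI)
    show "y \<sqsubseteq> snd (I n)" if "y \<in> range (fst \<circ> I)" for y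
      using that between by auto
  qed (rule c)
  moreover obtain n where "a n = s"
    using s(1) cnt unfolding a_def by (metis from_nat_into_surj)
  ultimately show False using I(4)[of n] s by auto
qed

context frame
begin

text \<open>The frame law distributes \<open>c = c \<sqinter> s\<close> over the supremum
  \<open>s\<close> of \<open>D\<close>. A directed set with supremum \<open>s\<close> is thus cut
  down to one with supremum \<open>c\<close>; this is the one appeal to
  \<open>inf_Sup_distrib\<close>.\<close>

lemma directed_meet:
  assumes D: "directed L D" and s: "is_lub L s D" and c: "c \<in> carrier L" "c \<sqsubseteq> s"
  shows "directed L ((\<lambda>d. c \<sqinter> d) ` D)" "is_lub L c ((\<lambda>d. c \<sqinter> d) ` D)"
proof -
  have Dc: "D \<subseteq> carrier L" and "D \<noteq> {}" using D by (auto simp: directed_def)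
  have sc: "s \<in> carrier L" using s by blast
  have "\<exists>w\<in>D. c \<sqinter> x \<sqsubseteq> c \<sqinter> w \<and> c \<sqinter> y \<sqsubseteq> c \<sqinter> w" if "x \<in> D" "y \<in> D" for x y
  proof -
    obtain w where w: "w \<in> D" "x \<sqsubseteq> w" "y \<sqsubseteq> w" using D \<open>x \<in> D\<close> \<open>y \<in> D\<close> unfolding directed_def by blast
    have "c \<sqinter> u \<sqsubseteq> c \<sqinter> w" if "u \<in> D" "u \<sqsubseteq> w" for u
    proof -
      have "u \<in> carrier L" "w \<in> carrier L" using that w Dc by auto
      then show ?thesis
        using c that meet_left[of c u] meet_right[of c u]
        by (meson le_trans meet_closed meet_le)
    qed
    then show ?thesis using w \<open>x \<in> D\<close> \<open>y \<in> D\<close> by blast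
  qed
  then show "directed L ((\<lambda>d. c \<sqinter> d) ` D)"
    using Dc \<open>D \<noteq> {}\<close> c unfolding directed_def by auto
  have "\<Squnion>\<^bsub>L\<^esub>D = s"
    using s sup_lub[OF Dc] least_unique by blast
  moreover have "c \<sqinter> s = c"
    using le_iff_join c sc by (metis le_iff_meet join_comm meet_comm)
  ultimately have "c = \<Squnion>\<^bsub>L\<^esub>((\<lambda>d. c \<sqinter> d) ` D)"
    using inf_Sup_distrib[OF c(1) Dc] by simp
  moreover have "(\<lambda>d. c \<sqinter> d) ` D \<subseteq> carrier L" using Dc c by auto
  ultimately show "is_lub L c ((\<lambda>d. c \<sqinter> d) ` D)"
    using sup_lub by metis
qed

end

section \<open>Moves on pairs, their ranks, and saturated sets\<close>

text \<open>Membership of \<open>((e', p'), (e, p))\<close> in \<open>r\<close> means that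
  \<open>(e', p')\<close> has lower rank. A suitable \<open>c\<close> is required in every
  \<open>W\<close> because the construction of the box prescribes the neighbourhood of
  \<open>p\<close> in which \<open>c\<close> has to lie.\<close>

definition shrinkable :: "('a, 'b) gorder_scheme \<Rightarrow> (('a \<times> 'a) \<times> ('a \<times> 'a)) set \<Rightarrow> 'a \<Rightarrow> 'a \<Rightarrow> bool" where
  "shrinkable L r e p \<longleftrightarrow>
     (\<forall>W. scott_open L W \<longrightarrow> p \<in> W \<longrightarrow> (\<exists>c\<in>W. c \<sqsubseteq>\<^bsub>L\<^esub> p \<and> ((e \<sqinter>\<^bsub>L\<^esub> c, c), (e, p)) \<in> r))"

text \<open>One \<open>W\<close> is enough, since every directed set with supremum \<open>p\<close>
  meets it. As \<open>p\<close> is kept, this move asks for no new element of the box.\<close>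

definition raisable :: "('a, 'b) gorder_scheme \<Rightarrow> (('a \<times> 'a) \<times> ('a \<times> 'a)) set \<Rightarrow> 'a \<Rightarrow> 'a \<Rightarrow> bool" where
  "raisable L r e p \<longleftrightarrow>
     (\<exists>W. scott_open L W \<and> p \<in> W \<and>
       (\<forall>d\<in>W. e \<sqsubseteq>\<^bsub>L\<^esub> d \<longrightarrow> d \<sqsubseteq>\<^bsub>L\<^esub> p \<longrightarrow> ((d, p), (e, p)) \<in> r))"

definition ranking :: "('a, 'b) gorder_scheme \<Rightarrow> (('a \<times> 'a) \<times> ('a \<times> 'a)) set \<Rightarrow> bool" where
  "ranking L r \<longleftrightarrow> wf r \<and>
     (\<forall>e\<in>carrier L. \<forall>p\<in>carrier L. e \<sqsubseteq>\<^bsub>L\<^esub> p \<longrightarrow>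
        e = p \<or> shrinkable L r e p \<or> raisable L r e p)"

text \<open>\<open>e\<close> ranges over the whole carrier and not just over \<open>A\<close>, since
  it will come from members of arbitrary directed sets.\<close>

definition saturated :: "('a, 'b) gorder_scheme \<Rightarrow> (('a \<times> 'a) \<times> ('a \<times> 'a)) set \<Rightarrow> 'a set \<Rightarrow> bool" where
  "saturated L r A \<longleftrightarrow> A \<subseteq> carrier L \<and>
     (\<forall>p\<in>A. \<forall>e\<in>carrier L. e \<sqsubseteq>\<^bsub>L\<^esub> p \<longrightarrow> shrinkable L r e p \<longrightarrow>
        (\<exists>c\<in>A. c \<sqsubseteq>\<^bsub>L\<^esub> p \<and> ((e \<sqinter>\<^bsub>L\<^esub> c, c), (e, p)) \<in> r))"

text \<open>\<open>F D\<close> consists of the pairs resolved by one move into \<open>D\<close>. If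
  it added no pair of \<open>S\<close>, the pairs in \<open>S - D\<close> would be a dense set of
  proper intervals.\<close>

lemma (in countable_frame) ex_ranking: "\<exists>r. ranking L r"
proof -
  define S where "S = {(e, p). e \<in> carrier L \<and> p \<in> carrier L \<and> e \<sqsubseteq> p}"
  define F where "F D = {(e, p). e = p
      \<or> (\<forall>W. scott_open L W \<longrightarrow> p \<in> W \<longrightarrow> (\<exists>c\<in>W. c \<sqsubseteq> p \<and> (e \<sqinter> c, c) \<in> D))
      \<or> (\<exists>W. scott_open L W \<and> p \<in> W \<and> (\<forall>d\<in>W. e \<sqsubseteq> d \<longrightarrow> d \<sqsubseteq> p \<longrightarrow> (d, p) \<in> D))}" for D
  have "\<exists>z\<in>S - D. z \<in> F D" if D: "\<not> S \<subseteq> D" for D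
  proof (rule ccontr)
    assume none: "\<not> (\<exists>z\<in>S - D. z \<in> F D)"
    have "S - D = {}"
    proof (rule no_dense_set_of_intervals[OF countable_carrier])
      show "e \<in> carrier L \<and> p \<in> carrier L \<and> e \<sqsubseteq> p \<and> e \<noteq> p" if "(e, p) \<in> S - D" for e p
        using that none by (auto simp: S_def F_def)
    next
      fix e p assume ep: "(e, p) \<in> S - D"
      then have notF: "(e, p) \<notin> F D" using none by blast
      have c: "e \<in> carrier L" "p \<in> carrier L" using ep by (auto simp: S_def)
      \<comment> \<open>\<open>W\<close> witnesses that shrinking fails. Raising fails for this same
        \<open>W\<close>, which yields \<open>d \<in> W\<close> between \<open>e\<close> and
        \<open>p\<close> with \<open>(d, p)\<close> unresolved; since
        \<open>e \<sqinter> d = e\<close>, the choice of \<open>W\<close> makes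
        \<open>(e, d)\<close> unresolved as well.\<close>
      obtain W where W: "scott_open L W" "p \<in> W" "\<And>c. c \<in> W \<Longrightarrow> c \<sqsubseteq> p \<Longrightarrow> (e \<sqinter> c, c) \<notin> D"
        using notF unfolding F_def by blast
      then obtain d where d: "d \<in> W" "e \<sqsubseteq> d" "d \<sqsubseteq> p" "(d, p) \<notin> D"
        using notF unfolding F_def by blast
      have dc: "d \<in> carrier L" using d W(1) by (auto simp: scott_open_def)
      then have "e \<sqinter> d = e" using c(1) d(2) le_iff_join by simp
      then have "(e, d) \<notin> D" using W(3)[OF d(1,3)] by simp
      then show "\<exists>d. (e, d) \<in> S - D \<and> (d, p) \<in> S - D"
        using d c dc by (auto simp: S_def)
    qed
    then show False using D by blast
  qed
  then obtain r where r: "wf r" "\<And>x. x \<in> S \<Longrightarrow> x \<in> F {y. (y, x) \<in> r}"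
    using wf_rank[of S F] by blast
  have "ranking L r"
    unfolding ranking_def shrinkable_def raisable_def
  proof (intro conjI ballI impI r(1))
    fix e p assume "e \<in> carrier L" "p \<in> carrier L" "e \<sqsubseteq> p"
    then show "e = p
      \<or> (\<forall>W. scott_open L W \<longrightarrow> p \<in> W \<longrightarrow> (\<exists>c\<in>W. c \<sqsubseteq> p \<and> ((e \<sqinter> c, c), (e, p)) \<in> r))
      \<or> (\<exists>W. scott_open L W \<and> p \<in> W \<and> (\<forall>d\<in>W. e \<sqsubseteq> d \<longrightarrow> d \<sqsubseteq> p \<longrightarrow> ((d, p), (e, p)) \<in> r))"
      using r(2)[of "(e, p)"] by (simp add: S_def F_def)
  qed
  then show ?thesis by blast
qed

text \<open>Induction along \<open>r\<close> on \<open>(e, p)\<close>, simultaneously for all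
  directed sets with supremum \<open>p\<close> and a member above \<open>e\<close>; the directed set
  must vary because shrinking replaces it.\<close>

lemma (in frame) scott_open_saturated:
  assumes r: "ranking L r" and A: "saturated L r A"
  shows "scott_open L {x \<in> carrier L. \<exists>a\<in>A. a \<sqsubseteq> x}"
proof -
  have Ac: "A \<subseteq> carrier L" using A by (simp add: saturated_def)
  have key: "\<exists>d\<in>D. \<exists>a\<in>A. a \<sqsubseteq> d"
    if "p \<in> A" "e \<in> carrier L" "e \<sqsubseteq> p" "directed L D" "is_lub L p D" "\<exists>d\<in>D. e \<sqsubseteq> d" for e p D
  proof -
    have "wf r" using r by (simp add: ranking_def)
    then show ?thesis using that
    proof (induction "(e, p)" arbitrary: e p D rule: wf_induct_rule)
      case less
      have Dc: "D \<subseteq> carrier L" using less.prems by (simp add: directed_def)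
      have pc: "p \<in> carrier L" using less.prems Ac by blast
      obtain d0 where d0: "d0 \<in> D" "e \<sqsubseteq> d0" using less.prems by blast
      consider "e = p" | "shrinkable L r e p" | "raisable L r e p"
        using r less.prems pc unfolding ranking_def by blast
      then show ?case
      proof cases
        case 1
        then show ?thesis using less.prems by blast
      next
        case 2
        then obtain c where c: "c \<in> A" "c \<sqsubseteq> p" "((e \<sqinter> c, c), (e, p)) \<in> r"
          using A less.prems unfolding saturated_def by blast
        have cc: "c \<in> carrier L" using c Ac by blast
        \<comment> \<open>The cut-down set has supremum \<open>c \<in> A\<close>, and its member
          \<open>c \<sqinter> d0\<close> lies above \<open>e \<sqinter> c\<close>, so the induction
          hypothesis applies to it. Whatever is below \<open>c \<sqinter> d\<close> is below
          \<open>d\<close>.\<close>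
        note dm = directed_meet[OF less.prems(4,5) cc c(2)]
        have "c \<sqinter> d0 \<in> carrier L" "e \<sqinter> c \<sqsubseteq> c \<sqinter> d0"
          using d0 Dc cc less.prems(2) meet_left meet_right
          by (auto intro!: meet_le) (meson le_trans meet_closed subsetD)
        then have "\<exists>d\<in>(\<lambda>d. c \<sqinter> d) ` D. \<exists>a\<in>A. a \<sqsubseteq> d"
          using d0 cc less.prems(2) by (intro less.hyps[OF c(3) c(1) _ _ dm]) (auto intro: meet_right)
        then obtain d a where "d \<in> D" "a \<in> A" "a \<sqsubseteq> c \<sqinter> d" by blast
        then show ?thesis using cc Dc Ac by (meson le_trans meet_closed meet_right subsetD)
      next
        case 3
        then obtain W where W: "scott_open L W" "p \<in> W"
          "\<And>d. d \<in> W \<Longrightarrow> e \<sqsubseteq> d \<Longrightarrow> d \<sqsubseteq> p \<Longrightarrow> ((d, p), (e, p)) \<in> r"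
          unfolding raisable_def by blast
        \<comment> \<open>An upper bound in \<open>D\<close> of \<open>d0\<close> and
          \<open>d1\<close> is above \<open>e\<close> and still in \<open>W\<close>; the same
          \<open>D\<close> then falls under the lower pair \<open>(d, p)\<close>.\<close>
        obtain d1 where d1: "d1 \<in> D" "d1 \<in> W"
          using W less.prems unfolding scott_open_def by blast
        obtain d where d: "d \<in> D" "d0 \<sqsubseteq> d" "d1 \<sqsubseteq> d"
          using less.prems(4) d0 d1 unfolding directed_def by blast
        have dc: "d \<in> carrier L" using d Dc by blast
        have "d \<in> W" using W(1) d1 d dc unfolding scott_open_def by blast
        moreover have "e \<sqsubseteq> d" using d0 d dc Dc less.prems(2) by (meson le_trans subsetD)
        moreover have "d \<sqsubseteq> p" using least_Upper_above[OF less.prems(5) d(1) Dc] .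
        ultimately show ?thesis
          using less.hyps[OF W(3)] less.prems d dc by blast
      qed
    qed
  qed
  show ?thesis
    unfolding scott_open_def
  proof (intro conjI ballI allI impI)
    fix x y assume "x \<in> {x \<in> carrier L. \<exists>a\<in>A. a \<sqsubseteq> x}" "y \<in> carrier L" "x \<sqsubseteq> y"
    then show "y \<in> {x \<in> carrier L. \<exists>a\<in>A. a \<sqsubseteq> x}"
      using Ac by (blast intro: le_trans)
  next
    fix D s assume D: "directed L D" "is_lub L s D" and s: "s \<in> {x \<in> carrier L. \<exists>a\<in>A. a \<sqsubseteq> x}"
    have Dc: "D \<subseteq> carrier L" "D \<noteq> {}" using D by (simp_all add: directed_def)
    obtain p where p: "p \<in> A" "p \<sqsubseteq> s" using s by blast
    have pc: "p \<in> carrier L" using p Ac by blast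
    \<comment> \<open>\<open>key\<close> wants a supremum in \<open>A\<close>, while
      \<open>s\<close> is only above some \<open>p \<in> A\<close>. Meeting \<open>D\<close> with
      \<open>p\<close> repairs this, and any member \<open>p \<sqinter> d0\<close> can serve as the
      initial \<open>e\<close>.\<close>
    note dm = directed_meet[OF D pc p(2)]
    obtain d0 where d0: "d0 \<in> D" using Dc by blast
    have "\<exists>d\<in>(\<lambda>d. p \<sqinter> d) ` D. \<exists>a\<in>A. a \<sqsubseteq> d"
    proof (rule key[OF p(1) _ _ dm])
      show "p \<sqinter> d0 \<in> carrier L" "p \<sqinter> d0 \<sqsubseteq> p"
        using d0 Dc pc by (auto intro: meet_left)
      then show "\<exists>d\<in>(\<lambda>d. p \<sqinter> d) ` D. p \<sqinter> d0 \<sqsubseteq> d" using d0 by auto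
    qed
    then obtain d a where "d \<in> D" "a \<in> A" "a \<sqsubseteq> p \<sqinter> d" by blast
    moreover then have "a \<sqsubseteq> d" using pc Dc Ac by (meson le_trans meet_closed meet_right subsetD)
    ultimately show "D \<inter> {x \<in> carrier L. \<exists>a\<in>A. a \<sqsubseteq> x} \<noteq> {}" using Dc by blast
  qed blast
qed

section \<open>Scott-open sets in products\<close>

lemma product_order_simps [simp]:
  "carrier (product_order I L) = (\<Pi>\<^sub>E i\<in>I. carrier (L i))"
  "x \<sqsubseteq>\<^bsub>product_order I L\<^esub> y \<longleftrightarrow> (\<forall>i\<in>I. x i \<sqsubseteq>\<^bsub>L i\<^esub> y i)"
  by (simp_all add: product_order_def)

lemma is_lub_iff:
  assumes "D \<subseteq> carrier P"
  shows "is_lub P s D \<longleftrightarrow> s \<in> carrier P \<and> (\<forall>d\<in>D. d \<sqsubseteq>\<^bsub>P\<^esub> s) \<and>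
    (\<forall>u\<in>carrier P. (\<forall>d\<in>D. d \<sqsubseteq>\<^bsub>P\<^esub> u) \<longrightarrow> s \<sqsubseteq>\<^bsub>P\<^esub> u)"
  using assms unfolding least_def Upper_def by blast

lemma is_lub_productI:
  assumes "s \<in> carrier (product_order I L)" "D \<subseteq> carrier (product_order I L)"
    and "\<And>i. i \<in> I \<Longrightarrow> is_lub (L i) (s i) ((\<lambda>x. x i) ` D)"
  shows "is_lub (product_order I L) s D"
proof -
  have sub: "(\<lambda>x. x i) ` D \<subseteq> carrier (L i)" if "i \<in> I" for i
    using assms(2) that by auto
  then show ?thesis
    using assms(1,3) by (simp add: is_lub_iff[OF assms(2)] is_lub_iff[OF sub] PiE_iff)
qed

text \<open>Completeness of the factors provides coordinatewise suprema; they assemble to a supremum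
  of \<open>D\<close>, and suprema are unique.\<close>

lemma is_lub_productD:
  assumes cl: "\<And>i. i \<in> I \<Longrightarrow> Complete_Lattice.complete_lattice (L i)"
    and D: "D \<subseteq> carrier (product_order I L)" and s: "is_lub (product_order I L) s D"
    and i: "i \<in> I"
  shows "is_lub (L i) (s i) ((\<lambda>x. x i) ` D)"
proof -
  have sub: "(\<lambda>x. x j) ` D \<subseteq> carrier (L j)" if "j \<in> I" for j
    using D that by auto
  have "\<exists>t. is_lub (L j) t ((\<lambda>x. x j) ` D)" if "j \<in> I" for j
    using complete_lattice.sup_exists[OF cl sub] that by blast
  then obtain t where t: "\<And>j. j \<in> I \<Longrightarrow> is_lub (L j) (t j) ((\<lambda>x. x j) ` D)" by metis
  have t': "restrict t I \<in> carrier (product_order I L)"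
    using least_closed[OF t] by simp
  have "is_lub (product_order I L) (restrict t I) D"
    by (rule is_lub_productI[OF t' D]) (simp add: t)
  then have le: "s \<sqsubseteq>\<^bsub>product_order I L\<^esub> restrict t I" "restrict t I \<sqsubseteq>\<^bsub>product_order I L\<^esub> s"
    using s least_le least_mem by metis+
  interpret Complete_Lattice.complete_lattice "L i" by (rule cl[OF i])
  have "s \<in> carrier (product_order I L)" using s by (rule least_closed)
  then have "s i = t i"
    using le t' i by (intro le_antisym) auto
  then show ?thesis using t i by simp
qed

lemma directed_image:
  assumes "directed P D" "\<And>x. x \<in> D \<Longrightarrow> f x \<in> carrier Q"
    and "\<And>x y. x \<in> D \<Longrightarrow> y \<in> D \<Longrightarrow> x \<sqsubseteq>\<^bsub>P\<^esub> y \<Longrightarrow> f x \<sqsubseteq>\<^bsub>Q\<^esub> f y"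
  shows "directed Q (f ` D)"
  unfolding directed_def
proof (intro conjI ballI)
  fix u v assume "u \<in> f ` D" "v \<in> f ` D"
  then obtain x y where xy: "x \<in> D" "y \<in> D" "u = f x" "v = f y" by blast
  then obtain z where "z \<in> D" "x \<sqsubseteq>\<^bsub>P\<^esub> z" "y \<sqsubseteq>\<^bsub>P\<^esub> z"
    using assms(1) unfolding directed_def by blast
  then show "\<exists>w\<in>f ` D. u \<sqsubseteq>\<^bsub>Q\<^esub> w \<and> v \<sqsubseteq>\<^bsub>Q\<^esub> w" using assms(3) xy by blast
qed (use assms in \<open>auto simp: directed_def\<close>)

lemma scott_open_coordinate:
  assumes cl: "\<And>i. i \<in> I \<Longrightarrow> Complete_Lattice.complete_lattice (L i)"
    and i: "i \<in> I" and V: "scott_open (L i) V"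
  shows "scott_open (product_order I L) {x \<in> carrier (product_order I L). x i \<in> V}"
  unfolding scott_open_def
proof (intro conjI ballI allI impI)
  fix x y assume x: "x \<in> {x \<in> carrier (product_order I L). x i \<in> V}"
    and y: "y \<in> carrier (product_order I L)" "x \<sqsubseteq>\<^bsub>product_order I L\<^esub> y"
  then have "y i \<in> carrier (L i)" "x i \<sqsubseteq>\<^bsub>L i\<^esub> y i" using i by auto
  then have "y i \<in> V" using V x unfolding scott_open_def by blast
  then show "y \<in> {x \<in> carrier (product_order I L). x i \<in> V}" using y by blast
next
  fix D s assume D: "directed (product_order I L) D" and s: "is_lub (product_order I L) s D"
    and sV: "s \<in> {x \<in> carrier (product_order I L). x i \<in> V}"
  have Dc: "D \<subseteq> carrier (product_order I L)" using D by (simp add: directed_def)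
  have "directed (L i) ((\<lambda>x. x i) ` D)"
    by (rule directed_image[OF D]) (use Dc i in auto)
  moreover have "is_lub (L i) (s i) ((\<lambda>x. x i) ` D)"
    by (rule is_lub_productD[OF cl Dc s i])
  ultimately have "(\<lambda>x. x i) ` D \<inter> V \<noteq> {}"
    using V sV unfolding scott_open_def by blast
  then show "D \<inter> {x \<in> carrier (product_order I L). x i \<in> V} \<noteq> {}" using Dc by blast
qed blast

text \<open>Inserting \<open>t\<close> at coordinate \<open>i\<close> preserves directed suprema, as
  the other coordinates stay constant.\<close>

lemma scott_open_slice:
  assumes po: "\<And>i. i \<in> I \<Longrightarrow> partial_order (L i)"
    and U: "scott_open (product_order I L) U"
    and y: "y \<in> carrier (product_order I L)" and i: "i \<in> I"
  shows "scott_open (L i) {t \<in> carrier (L i). y(i := t) \<in> U}"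
proof -
  have upd: "y(i := t) \<in> carrier (product_order I L)" if "t \<in> carrier (L i)" for t
    using y i that by (auto simp: PiE_iff extensional_def)
  have refl: "y j \<sqsubseteq>\<^bsub>L j\<^esub> y j" if "j \<in> I" for j
  proof -
    interpret partial_order "L j" by (rule po[OF that])
    show ?thesis using y that by auto
  qed
  show ?thesis
    unfolding scott_open_def
  proof (intro conjI ballI allI impI)
    fix t u assume t: "t \<in> {t \<in> carrier (L i). y(i := t) \<in> U}"
      and u: "u \<in> carrier (L i)" "t \<sqsubseteq>\<^bsub>L i\<^esub> u"
    have "y(i := t) \<sqsubseteq>\<^bsub>product_order I L\<^esub> y(i := u)" using u refl by simp
    then have "y(i := u) \<in> U" using U upd[OF u(1)] t unfolding scott_open_def by blast
    then show "u \<in> {t \<in> carrier (L i). y(i := t) \<in> U}" using u by blast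
  next
    fix D s assume D: "directed (L i) D" and s: "is_lub (L i) s D"
      and sU: "s \<in> {t \<in> carrier (L i). y(i := t) \<in> U}"
    have Dc: "D \<subseteq> carrier (L i)" "D \<noteq> {}" using D by (simp_all add: directed_def)
    have "directed (product_order I L) ((\<lambda>t. y(i := t)) ` D)"
    proof (rule directed_image[OF D])
      show "y(i := t) \<in> carrier (product_order I L)" if "t \<in> D" for t
        using upd Dc that by blast
    qed (use refl in simp)
    moreover have "is_lub (product_order I L) (y(i := s)) ((\<lambda>t. y(i := t)) ` D)"
    proof (rule is_lub_productI)
      show "y(i := s) \<in> carrier (product_order I L)"
        using s upd least_closed by blast
      show "(\<lambda>t. y(i := t)) ` D \<subseteq> carrier (product_order I L)" using upd Dc by blast
      fix j assume j: "j \<in> I"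
      show "is_lub (L j) ((y(i := s)) j) ((\<lambda>x. x j) ` (\<lambda>t. y(i := t)) ` D)"
      proof (cases "j = i")
        case True
        then show ?thesis using s by (simp add: image_image)
      next
        case False
        \<comment> \<open>Nonemptiness of \<open>D\<close> is what makes this a singleton rather
          than the empty set.\<close>
        then have "(\<lambda>x. x j) ` (\<lambda>t. y(i := t)) ` D = {y j}"
          using Dc by (simp add: image_image image_constant_conv)
        moreover have "y j \<in> carrier (L j)" using y j by auto
        ultimately show ?thesis using False refl[OF j] by (simp add: is_lub_iff)
      qed
    qed
    ultimately have "(\<lambda>t. y(i := t)) ` D \<inter> U \<noteq> {}"
      using U sU unfolding scott_open_def by blast
    then show "D \<inter> {t \<in> carrier (L i). y(i := t) \<in> U} \<noteq> {}" using Dc by blast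
  qed blast
qed

section \<open>Truncation to finitely many coordinates\<close>

definition extend_bottom :: "'i set \<Rightarrow> 'i set \<Rightarrow> ('i \<Rightarrow> ('a, 'b) gorder_scheme) \<Rightarrow> ('i \<Rightarrow> 'a) \<Rightarrow> ('i \<Rightarrow> 'a)" where
  "extend_bottom I F L g = (\<lambda>i\<in>I. if i \<in> F then g i else \<bottom>\<^bsub>L i\<^esub>)"

lemma extend_bottom_upd:
  "i \<in> F \<Longrightarrow> F \<subseteq> I \<Longrightarrow> extend_bottom I F L (g(i := t)) = (extend_bottom I F L g)(i := t)"
  by (auto simp: extend_bottom_def fun_eq_iff)

lemma extend_bottom_in_carrier:
  assumes cl: "\<And>i. i \<in> I \<Longrightarrow> Complete_Lattice.complete_lattice (L i)"
    and "\<And>i. i \<in> F \<Longrightarrow> i \<in> I \<Longrightarrow> g i \<in> carrier (L i)"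
  shows "extend_bottom I F L g \<in> carrier (product_order I L)"
proof -
  have "\<bottom>\<^bsub>L i\<^esub> \<in> carrier (L i)" if "i \<in> I" for i
  proof -
    interpret Complete_Lattice.complete_lattice "L i" by (rule cl[OF that])
    show ?thesis by simp
  qed
  then show ?thesis using assms(2) by (auto simp: extend_bottom_def)
qed

lemma extend_bottom_le:
  assumes cl: "\<And>i. i \<in> I \<Longrightarrow> Complete_Lattice.complete_lattice (L i)"
    and z: "z \<in> carrier (product_order I L)"
    and "\<And>i. i \<in> F \<Longrightarrow> i \<in> I \<Longrightarrow> g i \<sqsubseteq>\<^bsub>L i\<^esub> z i"
  shows "extend_bottom I F L g \<sqsubseteq>\<^bsub>product_order I L\<^esub> z"
proof -
  have "\<bottom>\<^bsub>L i\<^esub> \<sqsubseteq>\<^bsub>L i\<^esub> z i" if "i \<in> I" for i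
  proof -
    interpret Complete_Lattice.complete_lattice "L i" by (rule cl[OF that])
    show ?thesis using z that by (auto intro: bottom_lower)
  qed
  then show ?thesis using assms(3) by (auto simp: extend_bottom_def)
qed

text \<open>The truncations of \<open>x\<close> to finite sets of coordinates are directed with
  supremum \<open>x\<close>, so one of them is in \<open>U\<close>.\<close>

lemma scott_open_finite_support:
  assumes cl: "\<And>i. i \<in> I \<Longrightarrow> Complete_Lattice.complete_lattice (L i)"
    and U: "scott_open (product_order I L) U" and x: "x \<in> U"
  obtains F where "finite F" "F \<subseteq> I" "extend_bottom I F L x \<in> U"
proof -
  have xc: "x \<in> carrier (product_order I L)" using U x by (auto simp: scott_open_def)
  have refl: "x i \<sqsubseteq>\<^bsub>L i\<^esub> x i" if "i \<in> I" for i
  proof -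
    interpret Complete_Lattice.complete_lattice "L i" by (rule cl[OF that])
    show ?thesis using xc that by auto
  qed
  define D where "D = (\<lambda>F. extend_bottom I F L x) ` {F. finite F \<and> F \<subseteq> I}"
  have ec: "extend_bottom I F L x \<in> carrier (product_order I L)" for F
    by (rule extend_bottom_in_carrier[OF cl]) (use xc in auto)
  have mono: "extend_bottom I F L x \<sqsubseteq>\<^bsub>product_order I L\<^esub> extend_bottom I G L x" if "F \<subseteq> G" for F G
    by (rule extend_bottom_le[OF cl ec]) (use that refl in \<open>auto simp: extend_bottom_def\<close>)
  have "directed (product_order I L) D"
    unfolding directed_def
  proof (intro conjI ballI)
    fix u v assume "u \<in> D" "v \<in> D"
    then obtain F G where FG: "finite F" "F \<subseteq> I" "finite G" "G \<subseteq> I"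
      "u = extend_bottom I F L x" "v = extend_bottom I G L x" unfolding D_def by blast
    then have "extend_bottom I (F \<union> G) L x \<in> D" unfolding D_def by blast
    then show "\<exists>w\<in>D. u \<sqsubseteq>\<^bsub>product_order I L\<^esub> w \<and> v \<sqsubseteq>\<^bsub>product_order I L\<^esub> w"
      using mono[of F "F \<union> G"] mono[of G "F \<union> G"] FG by blast
  qed (use ec in \<open>auto simp: D_def\<close>)
  moreover have "is_lub (product_order I L) x D"
  proof (rule is_lub_productI[OF xc])
    show Dc: "D \<subseteq> carrier (product_order I L)" using ec unfolding D_def by blast
    fix i assume i: "i \<in> I"
    have sub: "(\<lambda>x. x i) ` D \<subseteq> carrier (L i)" using Dc i by auto
    \<comment> \<open>In coordinate \<open>i\<close> the supremum is attained, namely by the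
      truncation to \<open>{i}\<close>.\<close>
    have "extend_bottom I {i} L x \<in> D" unfolding D_def using i by blast
    moreover have "extend_bottom I {i} L x i = x i" using i by (simp add: extend_bottom_def)
    ultimately have "x i \<in> (\<lambda>x. x i) ` D" by (metis image_eqI)
    moreover have "d i \<sqsubseteq>\<^bsub>L i\<^esub> x i" if d: "d \<in> D" for d
    proof -
      obtain F where "d = extend_bottom I F L x" using d unfolding D_def by blast
      moreover have "extend_bottom I F L x \<sqsubseteq>\<^bsub>product_order I L\<^esub> x"
        by (rule extend_bottom_le[OF cl xc]) (use refl in auto)
      ultimately show ?thesis using i by simp
    qed
    ultimately show "is_lub (L i) (x i) ((\<lambda>x. x i) ` D)"
      using sub unfolding is_lub_iff[OF sub] by blast
  qed
  ultimately have "D \<inter> U \<noteq> {}" using U x unfolding scott_open_def by blast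
  then show thesis using that unfolding D_def by blast
qed

section \<open>Boxes and Scott-open sets of the product\<close>

lemma scott_open_INT:
  assumes "finite G" "\<And>g. g \<in> G \<Longrightarrow> scott_open P (V g)"
  shows "scott_open P ((\<Inter>g\<in>G. V g) \<inter> carrier P)"
  using openin_INT[of G "scott_topology P" V] assms by simp

lemma scott_open_box:
  assumes cl: "\<And>i. i \<in> I \<Longrightarrow> Complete_Lattice.complete_lattice (L i)"
    and fin: "finite {i \<in> I. V i \<noteq> carrier (L i)}"
    and V: "\<And>i. i \<in> I \<Longrightarrow> scott_open (L i) (V i)"
  shows "scott_open (product_order I L) (\<Pi>\<^sub>E i\<in>I. V i)"
proof -
  let ?F = "{i \<in> I. V i \<noteq> carrier (L i)}"
  let ?P = "product_order I L"
  have "scott_open ?P ((\<Inter>i\<in>?F. {x \<in> carrier ?P. x i \<in> V i}) \<inter> carrier ?P)"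
  proof (rule scott_open_INT[OF fin])
    fix i assume "i \<in> ?F"
    then have i: "i \<in> I" by simp
    show "scott_open ?P {x \<in> carrier ?P. x i \<in> V i}"
      by (rule scott_open_coordinate) (use cl V i in blast)+
  qed
  also have "(\<Inter>i\<in>?F. {x \<in> carrier ?P. x i \<in> V i}) \<inter> carrier ?P = (\<Pi>\<^sub>E i\<in>I. V i)"
  proof (intro equalityI subsetI)
    fix x assume x: "x \<in> (\<Inter>i\<in>?F. {x \<in> carrier ?P. x i \<in> V i}) \<inter> carrier ?P"
    have "x i \<in> V i" if "i \<in> I" for i
    proof (cases "V i = carrier (L i)")
      case True
      then show ?thesis using x that by (simp add: PiE_iff)
    next
      case False
      then show ?thesis using x that by blast
    qed
    then show "x \<in> (\<Pi>\<^sub>E i\<in>I. V i)" using x by (simp add: PiE_iff)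
  next
    have "V i \<subseteq> carrier (L i)" if "i \<in> I" for i
      using V[OF that] by (simp add: scott_open_def)
    then show "x \<in> (\<Inter>i\<in>?F. {x \<in> carrier ?P. x i \<in> V i}) \<inter> carrier ?P"
      if "x \<in> (\<Pi>\<^sub>E i\<in>I. V i)" for x
      using that by (auto simp: PiE_iff)
  qed
  finally show ?thesis .
qed


text \<open>A stage is a finite relation \<open>S\<close> whose section at \<open>i\<close> holds
  the values allowed in coordinate \<open>i\<close>. It admits only finitely many \<open>g\<close>,
  so the slices at \<open>i\<close> through them intersect in a Scott-open neighbourhood of
  \<open>p\<close>, and shrinkability finds \<open>c\<close> inside it.\<close>

lemma saturated_box_step:
  assumes cl: "\<And>i. i \<in> I \<Longrightarrow> Complete_Lattice.complete_lattice (L i)"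
    and U: "scott_open (product_order I L) U" and F: "finite F" "F \<subseteq> I"
    and S: "finite S" "S \<subseteq> Sigma F (\<lambda>i. carrier (L i))"
    and box: "\<And>g. g \<in> (\<Pi>\<^sub>E i\<in>F. S `` {i}) \<Longrightarrow> extend_bottom I F L g \<in> U"
    and p: "(i, p) \<in> S" and sh: "shrinkable (L i) r e p"
  obtains c where "c \<in> carrier (L i)" "c \<sqsubseteq>\<^bsub>L i\<^esub> p" "((e \<sqinter>\<^bsub>L i\<^esub> c, c), (e, p)) \<in> r"
    "\<And>g. g \<in> (\<Pi>\<^sub>E j\<in>F. insert (i, c) S `` {j}) \<Longrightarrow> extend_bottom I F L g \<in> U"
proof -
  let ?G = "\<Pi>\<^sub>E j\<in>F. S `` {j}"
  let ?slice = "\<lambda>g. {t \<in> carrier (L i). (extend_bottom I F L g)(i := t) \<in> U}"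
  have iF: "i \<in> F" and iI: "i \<in> I" and pc: "p \<in> carrier (L i)" using p S(2) F(2) by auto
  have finG: "finite ?G"
    by (rule finite_PiE[OF F(1)]) (rule finite_Image[OF S(1)])
  have gc: "extend_bottom I F L g \<in> carrier (product_order I L)" if "g \<in> ?G" for g
    by (rule extend_bottom_in_carrier[OF cl]) (use that S(2) in \<open>auto simp: PiE_iff\<close>)
  have po: "partial_order (L j)" if "j \<in> I" for j
  proof -
    interpret Complete_Lattice.complete_lattice "L j" by (rule cl[OF that])
    show ?thesis by (rule partial_order_axioms)
  qed
  define T where "T = (\<Inter>g\<in>?G. ?slice g) \<inter> carrier (L i)"
  have "scott_open (L i) T"
    unfolding T_def by (rule scott_open_INT[OF finG], rule scott_open_slice[OF po U gc iI])
  moreover have "p \<in> T"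
  proof -
    have "(extend_bottom I F L g)(i := p) \<in> U" if "g \<in> ?G" for g
    proof -
      have "g(i := p) \<in> ?G" using that p iF by (auto simp: PiE_iff extensional_def)
      then show ?thesis using box extend_bottom_upd[OF iF F(2)] by metis
    qed
    then show ?thesis using pc unfolding T_def by blast
  qed
  ultimately obtain c where c: "c \<in> T" "c \<sqsubseteq>\<^bsub>L i\<^esub> p" "((e \<sqinter>\<^bsub>L i\<^esub> c, c), (e, p)) \<in> r"
    using sh unfolding shrinkable_def by blast
  \<comment> \<open>A choice function with value \<open>c\<close> at \<open>i\<close> becomes an old
    one when \<open>c\<close> is replaced by \<open>p\<close>, and membership of \<open>c\<close> in
    \<open>T\<close> allows putting \<open>c\<close> back. Every other choice function is
    old.\<close>
  have "extend_bottom I F L g \<in> U" if g: "g \<in> (\<Pi>\<^sub>E j\<in>F. insert (i, c) S `` {j})" for g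
  proof (cases "g i = c")
    case True
    have "g(i := p) \<in> ?G"
    proof (rule PiE_I)
      fix j assume "j \<in> F"
      then show "(g(i := p)) j \<in> S `` {j}" using PiE_mem[OF g, of j] p by auto
    next
      fix j assume "j \<notin> F"
      then show "(g(i := p)) j = undefined" using PiE_arb[OF g, of j] iF by auto
    qed
    then have "(extend_bottom I F L (g(i := p)))(i := c) \<in> U" using c(1) unfolding T_def by blast
    moreover have "(extend_bottom I F L (g(i := p)))(i := c) = extend_bottom I F L g"
      using True iF iI by (auto simp: extend_bottom_def fun_eq_iff)
    ultimately show ?thesis by simp
  next
    case False
    have "g \<in> ?G"
    proof (rule PiE_I)
      fix j assume "j \<in> F"
      then show "g j \<in> S `` {j}" using PiE_mem[OF g, of j] False by auto
    qed (rule PiE_arb[OF g])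
    then show ?thesis by (rule box)
  qed
  then show thesis using that c unfolding T_def by blast
qed

lemma saturated_box:
  assumes cf: "\<And>i. i \<in> I \<Longrightarrow> countable_frame (L i)"
    and U: "scott_open (product_order I L) U" and F: "finite F" "F \<subseteq> I"
    and x: "x \<in> carrier (product_order I L)" "extend_bottom I F L x \<in> U"
  obtains A where "\<And>i. i \<in> F \<Longrightarrow> x i \<in> A i" "\<And>i. i \<in> F \<Longrightarrow> saturated (L i) (r i) (A i)"
    "\<And>g. g \<in> (\<Pi>\<^sub>E i\<in>F. A i) \<Longrightarrow> extend_bottom I F L g \<in> U"
proof -
  have cl: "Complete_Lattice.complete_lattice (L i)" if "i \<in> I" for i
    using cf[OF that] by (simp add: countable_frame_def frame_def)
  define K where "K = Sigma F (\<lambda>i. carrier (L i) \<times> carrier (L i))"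
  have "countable K"
    unfolding K_def
  proof (rule countable_SIGMA)
    show "countable F" using F(1) by (rule countable_finite)
    fix i assume "i \<in> F"
    then have "countable (carrier (L i))" using F(2) cf countable_frame.countable_carrier by blast
    then show "countable (carrier (L i) \<times> carrier (L i))" by simp
  qed
  \<comment> \<open>The second component of \<open>prod_decode\<close> makes \<open>t\<close> return to every task infinitely often, so that
    a task is also served after its \<open>p\<close> has entered a stage.\<close>
  define t where "t n = from_nat_into K (fst (prod_decode n))" for n
  define ok where "ok S \<longleftrightarrow> finite S \<and> S \<subseteq> Sigma F (\<lambda>i. carrier (L i)) \<and>
      (\<forall>g\<in>\<Pi>\<^sub>E i\<in>F. S `` {i}. extend_bottom I F L g \<in> U)" for S
  \<comment> \<open>The \<open>n\<close>-th task demands something only if its \<open>p\<close> is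
    already present in stage \<open>S\<close>.\<close>
  define hit where "hit n S S' \<longleftrightarrow> S \<subseteq> S' \<and>
      (\<forall>i e p. t n = (i, e, p) \<longrightarrow> (i, p) \<in> S \<longrightarrow> shrinkable (L i) (r i) e p \<longrightarrow>
        (\<exists>c. (i, c) \<in> S' \<and> c \<sqsubseteq>\<^bsub>L i\<^esub> p \<and> ((e \<sqinter>\<^bsub>L i\<^esub> c, c), (e, p)) \<in> r i))" for n S S'
  define S0 where "S0 = (\<lambda>i. (i, x i)) ` F"
  have ok0: "ok S0"
  proof -
    have "extend_bottom I F L g = extend_bottom I F L x" if "g \<in> (\<Pi>\<^sub>E i\<in>F. S0 `` {i})" for g
      using that unfolding S0_def extend_bottom_def by (auto simp: fun_eq_iff PiE_iff)
    then show ?thesis using x F unfolding ok_def S0_def by auto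
  qed
  have step: "\<exists>S'. ok S' \<and> hit n S S'" if "ok S" for n S
  proof -
    obtain i e p where iep: "t n = (i, e, p)" by (metis prod_cases3)
    show ?thesis
    proof (cases "(i, p) \<in> S \<and> shrinkable (L i) (r i) e p")
      case True
      have S: "finite S" "S \<subseteq> Sigma F (\<lambda>i. carrier (L i))"
        "\<And>g. g \<in> (\<Pi>\<^sub>E i\<in>F. S `` {i}) \<Longrightarrow> extend_bottom I F L g \<in> U"
        using that unfolding ok_def by blast+
      obtain c where c: "c \<in> carrier (L i)" "c \<sqsubseteq>\<^bsub>L i\<^esub> p" "((e \<sqinter>\<^bsub>L i\<^esub> c, c), (e, p)) \<in> r i"
        "\<And>g. g \<in> (\<Pi>\<^sub>E j\<in>F. insert (i, c) S `` {j}) \<Longrightarrow> extend_bottom I F L g \<in> U"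
        using saturated_box_step[OF cl U F S] True by metis
      have "i \<in> F" using True S(2) by blast
      then have "ok (insert (i, c) S)" using S c unfolding ok_def by blast
      moreover have "hit n S (insert (i, c) S)" using c iep unfolding hit_def by auto
      ultimately show ?thesis by blast
    next
      case False
      then have "hit n S S" using iep unfolding hit_def by auto
      then show ?thesis using that by blast
    qed
  qed
  have "\<exists>f. \<forall>n. (ok (f n) \<and> (n = 0 \<longrightarrow> f n = S0)) \<and> hit n (f n) (f (Suc n))"
    by (rule dependent_nat_choice) (use ok0 step in auto)
  then obtain S where S: "\<And>n. ok (S n)" "S 0 = S0" "\<And>n. hit n (S n) (S (Suc n))" by blast
  have mono: "S m \<subseteq> S n" if "m \<le> n" for m n
    using that by (rule lift_Suc_mono_le[rotated]) (use S(3) in \<open>simp add: hit_def\<close>)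
  define A where "A i = (\<Union>n. S n `` {i})" for i
  show thesis
  proof
    show "x i \<in> A i" if "i \<in> F" for i
      using that S(2) unfolding A_def S0_def by blast
  next
    fix i assume i: "i \<in> F"
    show "saturated (L i) (r i) (A i)"
      unfolding saturated_def
    proof (intro conjI ballI impI)
      show "A i \<subseteq> carrier (L i)" using S(1) unfolding A_def ok_def by blast
      fix p e assume p: "p \<in> A i" and e: "e \<in> carrier (L i)" and sh: "shrinkable (L i) (r i) e p"
      have "p \<in> carrier (L i)" using p \<open>A i \<subseteq> carrier (L i)\<close> by blast
      then have inK: "(i, e, p) \<in> K" using i e unfolding K_def by blast
      obtain m where m: "(i, p) \<in> S m" using p unfolding A_def by blast
      \<comment> \<open>The code of a pair is at least its second component, so
        \<open>m \<le> n\<close> and this visit to the task comes after \<open>p\<close> has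
        entered.\<close>
      define n where "n = prod_encode (to_nat_on K (i, e, p), m)"
      have "t n = (i, e, p)"
        unfolding t_def n_def using \<open>countable K\<close> inK by simp
      moreover have "(i, p) \<in> S n"
        using m mono[of m n] le_prod_encode_2 unfolding n_def by blast
      ultimately obtain c where "(i, c) \<in> S (Suc n)" "c \<sqsubseteq>\<^bsub>L i\<^esub> p" "((e \<sqinter>\<^bsub>L i\<^esub> c, c), (e, p)) \<in> r i"
        using S(3)[of n] sh unfolding hit_def by blast
      then show "\<exists>c\<in>A i. c \<sqsubseteq>\<^bsub>L i\<^esub> p \<and> ((e \<sqinter>\<^bsub>L i\<^esub> c, c), (e, p)) \<in> r i"
        unfolding A_def by blast
    qed
  next
    fix g assume g: "g \<in> (\<Pi>\<^sub>E i\<in>F. A i)"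
    \<comment> \<open>Since \<open>F\<close> is finite and the stages increase, all values of
      \<open>g\<close> occur in a single stage, where membership in \<open>U\<close> is
      known.\<close>
    have "\<forall>\<^sub>F n in sequentially. (i, g i) \<in> S n" if i: "i \<in> F" for i
    proof -
      obtain m where "(i, g i) \<in> S m" using PiE_mem[OF g i] unfolding A_def by blast
      then show ?thesis using mono by (auto simp: eventually_sequentially)
    qed
    then have "\<forall>\<^sub>F n in sequentially. \<forall>i\<in>F. (i, g i) \<in> S n"
      using F(1) by (simp add: eventually_ball_finite_distrib)
    then obtain n where "\<forall>i\<in>F. (i, g i) \<in> S n" by (auto simp: eventually_sequentially)
    then have "g \<in> (\<Pi>\<^sub>E i\<in>F. S n `` {i})" using g by (auto simp: PiE_iff)
    then show "extend_bottom I F L g \<in> U" using S(1)[of n] unfolding ok_def by blast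
  qed
qed

theorem scott_topology_product_order:
  assumes cf: "\<And>i. i \<in> I \<Longrightarrow> countable_frame (L i)"
  shows "scott_topology (product_order I L) = product_topology (\<lambda>i. scott_topology (L i)) I"
proof -
  have cl: "Complete_Lattice.complete_lattice (L i)" if "i \<in> I" for i
    using cf[OF that] by (simp add: countable_frame_def frame_def)
  \<comment> \<open>The right-hand side is the criterion of
    \<open>openin_product_topology_alt\<close> for openness in the product topology.\<close>
  have "scott_open (product_order I L) U \<longleftrightarrow>
      (\<forall>x\<in>U. \<exists>V. finite {i \<in> I. V i \<noteq> carrier (L i)} \<and> (\<forall>i\<in>I. scott_open (L i) (V i)) \<and>
        x \<in> Pi\<^sub>E I V \<and> Pi\<^sub>E I V \<subseteq> U)" (is "?open \<longleftrightarrow> ?boxes") for U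
  proof
    assume boxes: ?boxes
    have "\<exists>T. openin (scott_topology (product_order I L)) T \<and> x \<in> T \<and> T \<subseteq> U" if x: "x \<in> U" for x
    proof -
      obtain V where V: "finite {i \<in> I. V i \<noteq> carrier (L i)}" "\<forall>i\<in>I. scott_open (L i) (V i)"
        "x \<in> Pi\<^sub>E I V" "Pi\<^sub>E I V \<subseteq> U" using bspec[OF boxes x] by (elim exE conjE)
      have "openin (scott_topology (product_order I L)) (Pi\<^sub>E I V)"
        unfolding openin_scott_topology by (rule scott_open_box[OF cl V(1) bspec[OF V(2)]])
      then show ?thesis using V(3,4) by blast
    qed
    then show ?open using openin_subopen[of "scott_topology (product_order I L)" U] by auto
  next
    assume U: ?open
    show ?boxes
    proof
      fix x assume x: "x \<in> U"
      then have xc: "x \<in> carrier (product_order I L)" using U by (auto simp: scott_open_def)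
      obtain F where F: "finite F" "F \<subseteq> I" "extend_bottom I F L x \<in> U"
        using scott_open_finite_support[OF cl U x] by blast
      have "\<forall>i\<in>I. \<exists>r. ranking (L i) r" using cf countable_frame.ex_ranking by blast
      then obtain r where r: "\<And>i. i \<in> I \<Longrightarrow> ranking (L i) (r i)" by metis
      obtain A where A: "\<And>i. i \<in> F \<Longrightarrow> x i \<in> A i" "\<And>i. i \<in> F \<Longrightarrow> saturated (L i) (r i) (A i)"
        "\<And>g. g \<in> (\<Pi>\<^sub>E i\<in>F. A i) \<Longrightarrow> extend_bottom I F L g \<in> U"
        using saturated_box[OF cf U F(1,2) xc F(3), of r] by blast
      \<comment> \<open>On \<open>F\<close> the factor is the upper closure of a saturated set,
        hence Scott open; the remaining factors are unrestricted.\<close>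
      define V where
        "V i = (if i \<in> F then {y \<in> carrier (L i). \<exists>a\<in>A i. a \<sqsubseteq>\<^bsub>L i\<^esub> y} else carrier (L i))" for i
      have "finite {i \<in> I. V i \<noteq> carrier (L i)}"
        by (rule finite_subset[OF _ F(1)]) (auto simp: V_def)
      moreover have "scott_open (L i) (V i)" if "i \<in> I" for i
      proof -
        interpret countable_frame "L i" by (rule cf[OF that])
        show ?thesis
          using scott_open_saturated[OF r[OF that] A(2)] scott_open_carrier[of "L i"]
          by (auto simp: V_def)
      qed
      moreover have "x i \<in> V i" if i: "i \<in> I" for i
      proof -
        interpret countable_frame "L i" by (rule cf[OF i])
        have "x i \<in> carrier (L i)" using xc i by auto
        then show ?thesis using A(1)[of i] by (auto simp: V_def)
      qed
      then have "x \<in> Pi\<^sub>E I V" using xc by (auto simp: PiE_iff)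
      moreover have "Pi\<^sub>E I V \<subseteq> U"
      proof
        fix z assume z: "z \<in> Pi\<^sub>E I V"
        then have zc: "z \<in> carrier (product_order I L)"
          by (auto simp: PiE_iff V_def split: if_splits)
        have "\<exists>a\<in>A i. a \<sqsubseteq>\<^bsub>L i\<^esub> z i" if "i \<in> F" for i
        proof -
          have "i \<in> I" using F that by blast
          then show ?thesis using PiE_mem[OF z, of i] that by (simp add: V_def)
        qed
        then obtain g where g: "\<And>i. i \<in> F \<Longrightarrow> g i \<in> A i \<and> g i \<sqsubseteq>\<^bsub>L i\<^esub> z i" by metis
        \<comment> \<open>The point of \<open>U\<close> spanned by elements of the
          \<open>A i\<close> lies below \<open>z\<close>: by choice of \<open>g\<close> on
          \<open>F\<close>, and because it is bottom elsewhere.\<close>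
        have "extend_bottom I F L (restrict g F) \<in> U" by (rule A(3)) (use g in auto)
        moreover have "extend_bottom I F L (restrict g F) \<sqsubseteq>\<^bsub>product_order I L\<^esub> z"
          by (rule extend_bottom_le[OF cl zc]) (use g in auto)
        ultimately show "z \<in> U" using U zc unfolding scott_open_def by blast
      qed
      ultimately show "\<exists>V. finite {i \<in> I. V i \<noteq> carrier (L i)} \<and> (\<forall>i\<in>I. scott_open (L i) (V i)) \<and>
        x \<in> Pi\<^sub>E I V \<and> Pi\<^sub>E I V \<subseteq> U" by blast
    qed
  qed
  then show ?thesis
    by (simp add: topology_eq openin_product_topology_alt)
qed

theorem corollary4p4:
  shows "(\<forall>(I :: 'i set) (L :: 'i \<Rightarrow> 'a gorder).
            (\<forall>i\<in>I. countable_frame (L i)) \<longrightarrow>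
            scott_topology (product_order I L) = product_topology (\<lambda>i. scott_topology (L i)) I)
       \<and> (\<forall>(J :: 'i set) (M :: 'a gorder).
            countable_frame M \<longrightarrow>
            scott_topology (product_order J (\<lambda>_. M)) = product_topology (\<lambda>_. scott_topology M) J)"
  by (intro conjI allI impI; rule scott_topology_product_order) blast+

end
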